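(* Let $D_1,D_2\subset[0,1)\times\mathbb{R}^2$ be a pair of disjoint resonators repeated periodically with respect to $\Lambda=(1,0,0)^T\mathbb{Z}$, with material parameters $\delta_1v_1^2=:V_1\in\mathbb{C}\setminus\{0\}$ and $\delta_2v_2^2=:V_2\in\mathbb{C}\setminus\{0\}$. Let $Y^*=\mathbb{R}/2\pi\mathbb{Z}$ be the Brillouin zone and $\mathcal{C}^\alpha\in\mathbb{C}^{2\times2}$ the associated quasiperiodic generalized capacitance matrix. Put $\Sigma:=\{\omega\in\mathbb{C}:\omega^2\in\bigcup_{\alpha\in Y^*}\sigma(\mathcal{C}^\alpha)\}$ and $$W:=\left\{\omega\in\mathbb{C}\setminus\Sigma:\int_{Y^*}\frac{\det(\mathcal{C}^\alpha)-\omega^2\mathcal{C}^\alpha_{11}}{\det(\mathcal{C}^\alpha-\omega^2\mathrm{Id})}\,d\alpha=0\right\}.$$ Define $\Psi:\mathbb{C}\setminus(\Sigma\cup W)\to\mathbb{C}$, $\omega\mapsto V^{def}(\omega)$, by $$V^{def}(\omega)=V_1\left(1-\frac{1}{\frac{1}{|Y^*|}\int_{Y^*}\frac{\det(\mathcal{C}^\alpha)-\omega^2\mathcal{C}^\alpha_{11}}{\det(\mathcal{C}^\alpha-\omega^2\mathrm{Id})}\,d\alpha}\right).$$ Then for every $\omega\in\mathbb{C}\setminus(\Sigma\cup W)$, $\omega$ is a defect mode eigenfrequency of the defected structure obtained from the periodic structure by replacing the material parameter $V_1$ of the single resonator $D_1^0$ by $V^{def}(\omega)$.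
   Context: Geometry and material. $D_1,D_2\subset[0,1)\times\mathbb{R}^2$ are disjoint bounded smooth simply connected domains (resonators), $D_i^m:=D_i+(m,0,0)^T$ for $m\in\mathbb{Z}$, $\mathcal{D}:=\bigcup_m(D_1^m\cup D_2^m)$. The functions $\rho,\kappa$ on $\mathbb{R}^3$ take constant nonzero complex values $\rho_i^m,\kappa_i^m$ on $D_i^m$ and $\rho_b,\kappa_b$ on $\mathbb{R}^3\setminus\mathcal{D}$. With $v_i^m=\sqrt{\kappa_i^m/\rho_i^m}$ and $\delta_i^m=\rho_i^m/\rho_b$, the "material parameter" of $D_i^m$ is $\delta_i^m(v_i^m)^2=\kappa_i^m/\rho_b$. High contrast: $\delta_i^m=O(\delta)$ as $\delta\to0$. In the periodic structure the parameters do not depend on $m$ and one writes $\delta_i,v_i$. Capacitance matrix. Let $G(x)=-\frac{1}{4\pi|x|}$, $G^\alpha(x)=\sum_{m\in\mathbb{Z}}G(x-(m,0,0)^T)e^{i\alpha m}$ for $\alpha\in Y^*\setminus\{0\}$, $|Y^*|=2\pi$, $D=D_1\cup D_2$, $\mathcal{S}_D^\alpha[\phi](x)=\int_{\partial D}G^\alpha(x-y)\phi(y)\,d\sigma(y)$ (invertible $L^2(\partial D)\to H^1(\partial D)$), $C^\alpha_{ij}=-\int_{\partial D_i}(\mathcal{S}_D^\alpha)^{-1}[\chi_{\partial D_j}]\,d\sigma$, and $\mathcal{C}^\alpha_{ij}=\frac{\delta_iv_i^2}{|D_i|}C^\alpha_{ij}$, $i,j\in\{1,2\}$, where $|D_i|$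 is the volume. $\mathcal{C}^0$ is the limit of $\mathcal{C}^\alpha$ as $\alpha\to0$. $\sigma(\cdot)$ is the set of eigenvalues. Defects and defect modes. In finitely many resonators the material parameter $\delta_iv_i^2$ is replaced by $\delta_iv_i^2(1+x_i^m)$, $x_i^m\in\mathbb{C}$. A subwavelength solution is a family $(\omega_\delta,v_\delta)$, continuous in $\delta$, with $v_\delta\neq0$, $\omega_\delta\to0$ as $\delta\to0$, solving $\operatorname{div}(\rho^{-1}\nabla v)+\omega^2\kappa^{-1}v=0$ in $\mathbb{R}^3$. It is a localized (defect) mode, with defect mode eigenfrequency $\omega_\delta$, if $\int_{\mathbb{R}}|v_\delta(x_1,x_2,x_3)|^2dx_1<\infty$ for a.e. $(x_2,x_3)$ and $\omega_\delta^2\notin\bigcup_{\alpha}\sigma(\mathcal{C}^\alpha)$. Working characterization (quoted from earlier work, understood at leading order in $\delta$, taken as given and used as the operative meaning of the term). If only resonators in the cell $m=0$ are defected, with $X_0=\mathrm{diag}(x_1^0,x_2^0)$, then $\omega$ with $\omega^2\notin\bigcup_{\alpha\in Y^*}\sigma(\mathcal{C}^\alpha)$ is a defect mode eigenfrequency if and only if $\det(\mathrm{Id}-X_0T^0(\omega))=0$, where $T^0(\omega)=-\frac{1}{|Y^*|}\int_{Y^*}\mathcal{C}^\alpha(\mathcal{C}^\alpha-\omega^2\mathrm{Id})^{-1}d\alpha$ and $\mathcal{C}^\alpha$ is the capacitance matrix of the non-defected periodic structure. *)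

theory Defs
  imports "HOL-Analysis.Analysis"
begin

section \<open>Resonators\<close>

text \<open>The derivative of \<open>f\<close> on the open set \<open>U\<close> is given by the partial derivatives \<open>g i\<close>, which
  are in turn \<open>k\<close> times continuously differentiable.\<close>

primrec Ck_on :: "nat \<Rightarrow> (real^3) set \<Rightarrow> (real^3 \<Rightarrow> real) \<Rightarrow> bool" where
  "Ck_on 0 U f \<longleftrightarrow> continuous_on U f"
| "Ck_on (Suc k) U f \<longleftrightarrow>
     (\<exists>g :: 3 \<Rightarrow> real^3 \<Rightarrow> real.
        (\<forall>x\<in>U. (f has_derivative (\<lambda>h. \<Sum>i\<in>UNIV. g i x * h $ i)) (at x)) \<and>
        (\<forall>i. Ck_on k U (g i)))"

definition smooth_on :: "(real^3) set \<Rightarrow> (real^3 \<Rightarrow> real) \<Rightarrow> bool" where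
  "smooth_on U f \<longleftrightarrow> (\<forall>k. Ck_on k U f)"

text \<open>Near each boundary point the set is the sublevel set of a smooth function
  with nonvanishing derivative, i.e. it lies on one side of a smooth hypersurface.\<close>

definition smooth_boundary :: "(real^3) set \<Rightarrow> bool" where
  "smooth_boundary A \<longleftrightarrow>
     (\<forall>p\<in>frontier A. \<exists>U f. open U \<and> p \<in> U \<and> smooth_on U f \<and>
        (\<forall>x\<in>U. \<not> (f has_derivative (\<lambda>h. 0)) (at x)) \<and>
        A \<inter> U = {x\<in>U. f x < 0})"

definition resonator :: "(real^3) set \<Rightarrow> bool" where
  "resonator A \<longleftrightarrow> A \<noteq> {} \<and> open A \<and> connected A \<and> bounded A \<and> simply_connected A \<and>
     smooth_boundary A"

definition unit_cell :: "(real^3) set" where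
  "unit_cell = {x. 0 \<le> x $ 1 \<and> x $ 1 < 1}"


section \<open>Surface measure\<close>

text \<open>The surface measure is the two-dimensional Hausdorff measure. The factor \<open>pi / 4\<close> is the area
  of a planar disc of diameter 1, which makes the measure agree with the area of smooth
  surfaces. Boundedness of the covering sets is required since \<^const>\<open>diameter\<close> is only
  meaningful for bounded sets. The set function is countably additive on Borel sets,
  so \<^const>\<open>measure_of\<close> does not collapse.\<close>

definition hausdorff2_outer :: "(real^3) set \<Rightarrow> ennreal" where
  "hausdorff2_outer A =
     (SUP d\<in>{0<..}.
        INF E\<in>{E :: nat \<Rightarrow> (real^3) set.
                 A \<subseteq> (\<Union>n. E n) \<and> (\<forall>n. bounded (E n) \<and> diameter (E n) \<le> (d::real))}.
          (\<Sum>n. ennreal (pi / 4 * (diameter (E n))\<^sup>2)))"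

definition surface_measure :: "(real^3) measure" where
  "surface_measure = measure_of UNIV (sets borel) hausdorff2_outer"


section \<open>Quasiperiodic layer potential\<close>

definition lattice_vec :: "int \<Rightarrow> real^3" where
  "lattice_vec m = of_int m *\<^sub>R axis 1 1"

definition green :: "real^3 \<Rightarrow> complex" where
  "green x = - (1 / of_real (4 * pi * norm x))"

text \<open>The lattice sum converges only conditionally and is the limit of its symmetric
  partial sums.\<close>

definition quasi_green :: "real \<Rightarrow> real^3 \<Rightarrow> complex" where
  "quasi_green \<alpha> x =
     lim (\<lambda>N::nat. \<Sum>m\<in>{-int N..int N}.
       green (x - lattice_vec m) * exp (\<i> * of_real \<alpha> * of_int m))"

definition single_layer ::
  "(real^3) set \<Rightarrow> real \<Rightarrow> (real^3 \<Rightarrow> complex) \<Rightarrow> real^3 \<Rightarrow> complex" where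
  "single_layer A \<alpha> \<phi> x = (LINT y:frontier A|surface_measure. quasi_green \<alpha> (x - y) * \<phi> y)"

definition L2_boundary :: "(real^3) set \<Rightarrow> (real^3 \<Rightarrow> complex) set" where
  "L2_boundary A = {\<phi>. set_borel_measurable surface_measure (frontier A) \<phi> \<and>
     set_integrable surface_measure (frontier A) (\<lambda>y. (norm (\<phi> y))\<^sup>2)}"

text \<open>A representative of the preimage of \<open>g\<close> under the single layer operator on square integrable
  densities. By injectivity it is unique up to null sets of the boundary.\<close>

definition single_layer_inv ::
  "(real^3) set \<Rightarrow> real \<Rightarrow> (real^3 \<Rightarrow> complex) \<Rightarrow> real^3 \<Rightarrow> complex" where
  "single_layer_inv A \<alpha> g =
     (SOME \<phi>. \<phi> \<in> L2_boundary A \<and>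
        (AE x in surface_measure. x \<in> frontier A \<longrightarrow> single_layer A \<alpha> \<phi> x = g x))"


section \<open>Capacitance matrices\<close>

definition capacitance :: "(2 \<Rightarrow> (real^3) set) \<Rightarrow> real \<Rightarrow> complex^2^2" where
  "capacitance D \<alpha> = (\<chi> i j.
     - (LINT x:frontier (D i)|surface_measure.
          single_layer_inv (D 1 \<union> D 2) \<alpha> (indicator (frontier (D j))) x))"

text \<open>\<open>V i\<close> is the material parameter of the \<open>i\<close>-th resonator of the periodic structure.\<close>

definition gen_capacitance_nonzero ::
  "(2 \<Rightarrow> (real^3) set) \<Rightarrow> (2 \<Rightarrow> complex) \<Rightarrow> real \<Rightarrow> complex^2^2" where
  "gen_capacitance_nonzero D V \<alpha> =
     (\<chi> i j. V i / of_real (measure lborel (D i)) * capacitance D \<alpha> $ i $ j)"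

definition gen_capacitance ::
  "(2 \<Rightarrow> (real^3) set) \<Rightarrow> (2 \<Rightarrow> complex) \<Rightarrow> real \<Rightarrow> complex^2^2" where
  "gen_capacitance D V \<alpha> =
     (if \<alpha> = 0 then Lim (at 0) (gen_capacitance_nonzero D V)
      else gen_capacitance_nonzero D V \<alpha>)"

text \<open>A fundamental domain of the Brillouin zone, the reals modulo \<open>2 * pi\<close>;
  every quantity above is \<open>2 * pi\<close>-periodic in the quasiperiodicity away from 0.\<close>

definition brillouin :: "real set" where
  "brillouin = {-pi..<pi}"

definition eigenvalues :: "complex^2^2 \<Rightarrow> complex set" where
  "eigenvalues A = {z. \<exists>u. u \<noteq> 0 \<and> A *v u = z *s u}"

definition band_spectrum ::
  "(2 \<Rightarrow> (real^3) set) \<Rightarrow> (2 \<Rightarrow> complex) \<Rightarrow> complex set" where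
  "band_spectrum D V = (\<Union>\<alpha>\<in>brillouin. eigenvalues (gen_capacitance D V \<alpha>))"


section \<open>Defect modes\<close>

text \<open>The integral of a matrix-valued function is taken entrywise.\<close>

definition T0 :: "(2 \<Rightarrow> (real^3) set) \<Rightarrow> (2 \<Rightarrow> complex) \<Rightarrow> complex \<Rightarrow> complex^2^2" where
  "T0 D V \<omega> = (\<chi> i j.
     - (1 / of_real (2 * pi)) *
       (LINT \<alpha>:brillouin|lborel.
          (gen_capacitance D V \<alpha> ** matrix_inv (gen_capacitance D V \<alpha> - mat (\<omega>\<^sup>2))) $ i $ j))"

text \<open>\<open>P m i\<close> is the material parameter of the translate \<open>D i + lattice_vec m\<close> in the defected structure
  and \<open>V\<close> that of the unperturbed periodic structure; only the cell \<open>m = 0\<close> may be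
  defected. Being a defect mode eigenfrequency is understood at leading order in the contrast:
  \<open>\<omega>\<close> lies off the band spectrum and is a root of the characteristic equation of the defect.\<close>

definition defect_mode_eigenfrequency ::
  "(2 \<Rightarrow> (real^3) set) \<Rightarrow> (2 \<Rightarrow> complex) \<Rightarrow> (int \<Rightarrow> 2 \<Rightarrow> complex) \<Rightarrow> complex \<Rightarrow> bool" where
  "defect_mode_eigenfrequency D V P \<omega> \<longleftrightarrow>
     \<omega>\<^sup>2 \<notin> band_spectrum D V \<and>
     (\<exists>x :: 2 \<Rightarrow> complex.
        (\<forall>m i. P m i = (if m = 0 then V i * (1 + x i) else V i)) \<and>
        det (mat 1 - (\<chi> i j. if i = j then x i else 0) ** T0 D V \<omega>) = 0)"

definition band_frequencies ::
  "(2 \<Rightarrow> (real^3) set) \<Rightarrow> (2 \<Rightarrow> complex) \<Rightarrow> complex set" where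
  "band_frequencies D V = {\<omega>. \<omega>\<^sup>2 \<in> band_spectrum D V}"

definition defect_integral ::
  "(2 \<Rightarrow> (real^3) set) \<Rightarrow> (2 \<Rightarrow> complex) \<Rightarrow> complex \<Rightarrow> complex" where
  "defect_integral D V \<omega> =
     (LINT \<alpha>:brillouin|lborel.
        (det (gen_capacitance D V \<alpha>) - \<omega>\<^sup>2 * gen_capacitance D V \<alpha> $ 1 $ 1) /
        det (gen_capacitance D V \<alpha> - mat (\<omega>\<^sup>2)))"

definition exceptional_frequencies ::
  "(2 \<Rightarrow> (real^3) set) \<Rightarrow> (2 \<Rightarrow> complex) \<Rightarrow> complex set" where
  "exceptional_frequencies D V = {\<omega> \<in> - band_frequencies D V. defect_integral D V \<omega> = 0}"

definition V_def ::
  "(2 \<Rightarrow> (real^3) set) \<Rightarrow> (2 \<Rightarrow> complex) \<Rightarrow> complex \<Rightarrow> complex" where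
  "V_def D V \<omega> = V 1 * (1 - 1 / (1 / of_real (2 * pi) * defect_integral D V \<omega>))"

end

theory Submission
  imports Defs
begin

text \<open>Changing \<open>V 1\<close> into \<open>V 1 * (1 + x 1)\<close> and keeping \<open>V 2\<close> is a perturbation of rank one: the
  matrix \<open>diag (x 1, 0)\<close> has a vanishing second row, so the characteristic determinant of the
  defect collapses to the scalar \<open>1 - x 1 * T\<close>, where \<open>T\<close> is the upper left entry of the
  Brillouin zone average \<^const>\<open>T0\<close>.

  Off the band spectrum every \<open>C - \<omega>\<^sup>2\<close>, with \<open>C\<close> the generalized capacitance matrix at some
  quasiperiodicity, is invertible. The adjugate formula then turns the upper left entry of
  \<open>C (C - \<omega>\<^sup>2)\<^sup>-\<^sup>1\<close> into the quotient of determinants in \<^const>\<open>defect_integral\<close>, whence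
  \<open>T = - I / (2 * pi)\<close> for the defect integral \<open>I\<close>. The scalar equation \<open>1 - x 1 * T = 0\<close>
  therefore has the solution \<open>x 1 = - 2 * pi / I\<close> as soon as \<open>I\<close> is nonzero, and
  \<open>V 1 * (1 + x 1)\<close> is exactly the value of \<^const>\<open>V_def\<close>.\<close>

lemma det_sub_mat_nonzero:
  assumes "z \<notin> eigenvalues A"
  shows "det (A - mat z) \<noteq> 0"
proof
  assume "det (A - mat z) = 0"
  then have "\<not> (\<exists>B. B ** (A - mat z) = mat 1)"
    using invertible_det_nz invertible_left_inverse by blast
  then obtain u where u: "u \<noteq> 0" "(A - mat z) *v u = 0"
    unfolding matrix_left_invertible_ker by blast
  have "A *v u = z *s u"
    using u(2) by (simp add: vec_eq_iff forall_2 matrix_vector_mult_def mat_def sum_2 algebra_simps)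
  with u(1) assms show False
    unfolding eigenvalues_def by blast
qed

lemma matrix_inv_unique:
  fixes A :: "'a::semiring_1^'n^'m"
  assumes "A ** B = mat 1" and "B ** A = mat 1"
  shows "matrix_inv A = B"
proof -
  have inv: "A ** matrix_inv A = mat 1 \<and> matrix_inv A ** A = mat 1"
    unfolding matrix_inv_def by (rule someI[of _ B]) (simp add: assms)
  have "matrix_inv A = matrix_inv A ** (A ** B)"
    by (simp add: assms)
  also have "\<dots> = B"
    using inv by (simp add: matrix_mul_assoc)
  finally show ?thesis .
qed

text \<open>The right-hand side is the adjugate divided by the determinant: the diagonal entries are
  exchanged and the others change sign.\<close>

lemma matrix_inv_2:
  fixes A :: "'a::field^2^2"
  assumes "det A \<noteq> 0"
  shows "matrix_inv A = (\<chi> i j. (if i = j then (if i = 1 then A $ 2 $ 2 else A $ 1 $ 1)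
                               else - A $ i $ j) / det A)"
    (is "_ = ?B")
proof -
  have det: "A $ 1 $ 1 * A $ 2 $ 2 = det A + A $ 1 $ 2 * A $ 2 $ 1"
    by (simp add: det_2)
  have "A ** ?B = mat 1"
    using assms det
    by (simp add: vec_eq_iff forall_2 matrix_matrix_mult_def mat_def sum_2
        add_divide_distrib mult.commute)
  moreover have "?B ** A = mat 1"
    using assms det
    by (simp add: vec_eq_iff forall_2 matrix_matrix_mult_def mat_def sum_2
        add_divide_distrib mult.commute)
  ultimately show ?thesis
    by (rule matrix_inv_unique)
qed

text \<open>The upper left entry is \<open>(a (d - z) - b c) / det (A - z)\<close> for \<open>A\<close> with rows \<open>(a, b)\<close> and
  \<open>(c, d)\<close>; the numerator regroups into \<open>det A - z a\<close>.\<close>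

lemma mult_resolvent_entry_11:
  fixes A :: "'a::field^2^2"
  assumes "det (A - mat z) \<noteq> 0"
  shows "(A ** matrix_inv (A - mat z)) $ 1 $ 1 = (det A - z * A $ 1 $ 1) / det (A - mat z)"
proof -
  have "(A ** matrix_inv (A - mat z)) $ 1 $ 1 =
      (A $ 1 $ 1 * (A $ 2 $ 2 - z) - A $ 1 $ 2 * A $ 2 $ 1) / det (A - mat z)"
    unfolding matrix_inv_2[OF assms]
    by (simp add: matrix_matrix_mult_def sum_2 mat_def diff_divide_distrib)
  also have "A $ 1 $ 1 * (A $ 2 $ 2 - z) - A $ 1 $ 2 * A $ 2 $ 1 = det A - z * A $ 1 $ 1"
    by (simp add: det_2 algebra_simps)
  finally show ?thesis .
qed

lemma T0_entry_11:
  assumes "\<omega>\<^sup>2 \<notin> band_spectrum D V"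
  shows "T0 D V \<omega> $ 1 $ 1 = - (1 / of_real (2 * pi)) * defect_integral D V \<omega>"
proof -
  have "(gen_capacitance D V \<alpha> ** matrix_inv (gen_capacitance D V \<alpha> - mat (\<omega>\<^sup>2))) $ 1 $ 1 =
      (det (gen_capacitance D V \<alpha>) - \<omega>\<^sup>2 * gen_capacitance D V \<alpha> $ 1 $ 1) /
        det (gen_capacitance D V \<alpha> - mat (\<omega>\<^sup>2))"
    if "\<alpha> \<in> brillouin" for \<alpha>
    using that assms unfolding band_spectrum_def
    by (intro mult_resolvent_entry_11 det_sub_mat_nonzero) blast
  then have "(LINT \<alpha>:brillouin|lborel.
      (gen_capacitance D V \<alpha> ** matrix_inv (gen_capacitance D V \<alpha> - mat (\<omega>\<^sup>2))) $ 1 $ 1) =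
      defect_integral D V \<omega>"
    unfolding defect_integral_def set_lebesgue_integral_def
    by (intro Bochner_Integration.integral_cong refl) (auto simp: indicator_def)
  then show ?thesis
    by (simp add: T0_def)
qed

lemma det_one_minus_single_defect:
  fixes T :: "'a::comm_ring_1^2^2"
  assumes "x 2 = 0"
  shows "det (mat 1 - (\<chi> i j. if i = j then x i else 0) ** T) = 1 - x 1 * T $ 1 $ 1"
  using assms by (simp add: det_2 matrix_matrix_mult_def mat_def sum_2)

theorem theorem2:
  fixes D :: "2 \<Rightarrow> (real^3) set" and \<delta> v V :: "2 \<Rightarrow> complex"
  assumes "\<And>i. resonator (D i)"
    and "\<And>i. D i \<subseteq> unit_cell"
    and "D 1 \<inter> D 2 = {}"
    and "\<And>i. V i = \<delta> i * (v i)\<^sup>2"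
    and "V 1 \<noteq> 0" and "V 2 \<noteq> 0"
  shows "\<forall>\<omega> \<in> - (band_frequencies D V \<union> exceptional_frequencies D V).
           defect_mode_eigenfrequency D V ((\<lambda>m. V)(0 := V(1 := V_def D V \<omega>))) \<omega>"
proof
  fix \<omega>
  assume \<omega>: "\<omega> \<in> - (band_frequencies D V \<union> exceptional_frequencies D V)"
  let ?I = "defect_integral D V \<omega>"
  have off_band: "\<omega>\<^sup>2 \<notin> band_spectrum D V" and I: "?I \<noteq> 0"
    using \<omega> by (auto simp: band_frequencies_def exceptional_frequencies_def)
  define x :: "2 \<Rightarrow> complex" where "x = (\<lambda>i. if i = 1 then - (of_real (2 * pi) / ?I) else 0)"
  have "V_def D V \<omega> = V 1 * (1 + x 1)"
    by (simp add: V_def_def x_def)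
  then have "((\<lambda>m. V)(0 := V(1 := V_def D V \<omega>))) m i = (if m = 0 then V i * (1 + x i) else V i)"
    for m :: int and i
    by (simp add: x_def)
  moreover have "det (mat 1 - (\<chi> i j. if i = j then x i else 0) ** T0 D V \<omega>) = 0"
  proof -
    have "x 1 * T0 D V \<omega> $ 1 $ 1 = 1"
      using I by (simp add: T0_entry_11[OF off_band] x_def)
    moreover have "x 2 = 0"
      by (simp add: x_def)
    ultimately show ?thesis
      by (simp add: det_one_minus_single_defect)
  qed
  ultimately show "defect_mode_eigenfrequency D V ((\<lambda>m. V)(0 := V(1 := V_def D V \<omega>))) \<omega>"
    using off_band unfolding defect_mode_eigenfrequency_def by blast
qed

end
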